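(* Consider the Gram-Schmidt walk run on input $v_1,\dots,v_n\in\mathbb{R}^m$ with $\|v_i\|_2\le 1$ and $x_0\in[-1,1]^n$, producing $x_n\in\{-1,1\}^n$. Fix $\theta\in\mathbb{R}^m$ and let $\mathrm{disc}_n:=\sum_{i=1}^n (x_n(i)-x_0(i))\langle\theta,v_i\rangle$. Then \[\mathbb{E}[e^{\mathrm{disc}_n}]\le e^{20\|\theta\|_2^2}.\]
   Context: The Gram-Schmidt walk: Input vectors $v_1,\dots,v_n\in\mathbb{R}^m$ with $\|v_i\|_2\le 1$ and $x_0\in[-1,1]^n$. For $t=1,2,\dots$: let $A_t=\{i\in[n]:|x_{t-1}(i)|<1\}$; if $A_t=\emptyset$ stop. Otherwise let the pivot be $n(t)=\max A_t$, let $V_t=\mathrm{span}\{v_i: i\in A_t, i\ne n(t)\}$, and let $v^\perp(t)$ be the orthogonal projection of $v_{n(t)}$ onto $V_t^\perp$. Choose $u_t\in\mathbb{R}^n$ with $u_t(i)=0$ for $i\notin A_t$, $u_t(n(t))=1$, and $u_t(i)$ for $i\in A_t\setminus\{n(t)\}$ chosen so that $v^\perp(t)=v_{n(t)}+\sum_{i\in A_t\setminus\{n(t)\}}u_t(i)v_i$. Let $\delta_t^-<0<\delta_t^+$ be the unique negative and positive solutions of $\max_{i\in A_t}|x_{t-1}(i)+\delta u_t(i)|=1$. Set $x_t=x_{t-1}+\delta_t u_t$, where $\delta_t=\delta_t^-$ with probability $\delta_t^+/(\delta_t^+-\delta_t^-)$ and $\delta_t=\delta_t^+$ with probability $-\delta_t^-/(\delta_t^+-\delta_t^-)$.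 The walk stops after some $T\le n$ steps; one sets $x_{T+1}=\dots=x_n:=x_T$, so $x_n\in\{-1,1\}^n$ is the output. *)

theory Defs
  imports "HOL-Probability.Probability"
begin

text \<open>A fractional colouring in \<open>\<real>\<^sup>n\<close> is a function \<open>nat \<Rightarrow> real\<close> of which only the values on
  \<open>{1..n}\<close> matter.\<close>

definition alive :: "nat \<Rightarrow> (nat \<Rightarrow> real) \<Rightarrow> nat set" where
  "alive n x = {i \<in> {1..n}. \<bar>x i\<bar> < 1}"

definition pivot :: "nat \<Rightarrow> (nat \<Rightarrow> real) \<Rightarrow> nat" where
  "pivot n x = Max (alive n x)"

definition orth_proj :: "'a::euclidean_space set \<Rightarrow> 'a \<Rightarrow> 'a" where
  "orth_proj W y = (THE w. w \<in> W \<and> y - w \<in> W\<^sup>\<bottom>)"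

definition v_perp :: "nat \<Rightarrow> (nat \<Rightarrow> 'a::euclidean_space) \<Rightarrow> (nat \<Rightarrow> real) \<Rightarrow> 'a" where
  "v_perp n v x = orth_proj ((span (v ` (alive n x - {pivot n x})))\<^sup>\<bottom>) (v (pivot n x))"

definition admissible_direction ::
    "nat \<Rightarrow> (nat \<Rightarrow> 'a::euclidean_space) \<Rightarrow> (nat \<Rightarrow> real) \<Rightarrow> (nat \<Rightarrow> real) \<Rightarrow> bool" where
  "admissible_direction n v x u \<longleftrightarrow>
     (\<forall>i. i \<notin> alive n x \<longrightarrow> u i = 0) \<and> u (pivot n x) = 1 \<and>
     v_perp n v x = v (pivot n x) + (\<Sum>i \<in> alive n x - {pivot n x}. u i *\<^sub>R v i)"

definition delta_pos :: "nat \<Rightarrow> (nat \<Rightarrow> real) \<Rightarrow> (nat \<Rightarrow> real) \<Rightarrow> real" where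
  "delta_pos n x u = (THE \<delta>. \<delta> > 0 \<and> Max ((\<lambda>i. \<bar>x i + \<delta> * u i\<bar>) ` alive n x) = 1)"

definition delta_neg :: "nat \<Rightarrow> (nat \<Rightarrow> real) \<Rightarrow> (nat \<Rightarrow> real) \<Rightarrow> real" where
  "delta_neg n x u = (THE \<delta>. \<delta> < 0 \<and> Max ((\<lambda>i. \<bar>x i + \<delta> * u i\<bar>) ` alive n x) = 1)"

definition gsw_step :: "nat \<Rightarrow> (nat \<Rightarrow> real) \<Rightarrow> (nat \<Rightarrow> real) \<Rightarrow> (nat \<Rightarrow> real) pmf" where
  "gsw_step n x u =
     (if alive n x = {} then return_pmf x
      else map_pmf (\<lambda>b i. x i + (if b then delta_pos n x u else delta_neg n x u) * u i)
             (bernoulli_pmf (- delta_neg n x u / (delta_pos n x u - delta_neg n x u))))"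

text \<open>When the alive vectors are linearly dependent the direction \<open>u\<^sub>t\<close> is not unique. The walk
  is therefore parametrised by a rule \<open>U\<close> that picks \<open>u\<^sub>t\<close> from the whole past
  \<open>[x\<^sub>t\<^sub>-\<^sub>1, \<dots>, x\<^sub>0]\<close>, most recent position first.\<close>

definition direction_rule ::
    "nat \<Rightarrow> (nat \<Rightarrow> 'a::euclidean_space) \<Rightarrow> ((nat \<Rightarrow> real) list \<Rightarrow> nat \<Rightarrow> real) \<Rightarrow> bool" where
  "direction_rule n v U \<longleftrightarrow>
     (\<forall>x h. alive n x \<noteq> {} \<longrightarrow> admissible_direction n v x (U (x # h)))"

primrec gsw_history ::
    "nat \<Rightarrow> ((nat \<Rightarrow> real) list \<Rightarrow> nat \<Rightarrow> real) \<Rightarrow> (nat \<Rightarrow> real) \<Rightarrow> nat \<Rightarrow> (nat \<Rightarrow> real) list pmf" where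
  "gsw_history n U x0 0 = return_pmf [x0]"
| "gsw_history n U x0 (Suc t) =
     bind_pmf (gsw_history n U x0 t) (\<lambda>h. map_pmf (\<lambda>x. x # h) (gsw_step n (hd h) (U h)))"

text \<open>The law of the output \<open>x\<^sub>n\<close>; the input vectors enter only through \<open>U\<close>.\<close>

definition gsw_output ::
    "nat \<Rightarrow> ((nat \<Rightarrow> real) list \<Rightarrow> nat \<Rightarrow> real) \<Rightarrow> (nat \<Rightarrow> real) \<Rightarrow> (nat \<Rightarrow> real) pmf" where
  "gsw_output n U x0 = map_pmf hd (gsw_history n U x0 n)"

definition disc ::
    "nat \<Rightarrow> (nat \<Rightarrow> 'a::euclidean_space) \<Rightarrow> 'a \<Rightarrow> (nat \<Rightarrow> real) \<Rightarrow> (nat \<Rightarrow> real) \<Rightarrow> real" where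
  "disc n v \<theta> x0 x = (\<Sum>i=1..n. (x i - x0 i) * (\<theta> \<bullet> v i))"

end

theory Submission
  imports Defs
begin

text \<open>Write \<open>A\<close> for the alive set, \<open>p\<close> for the pivot, \<open>Q\<close> for the squared norm of the projection of
  \<open>\<theta>\<close> onto the span of the alive vectors, and \<open>a\<close> for the inner product of \<open>\<theta>\<close> with the
  residual of \<open>v\<^sub>p\<close>. Let \<open>H x a = exp (- a * x) * (cosh a + x * sinh a)\<close>.
  The potential \<open>exp (Q - a\<^sup>2) * H (x p) a\<close> times \<open>exp disc\<close> is a supermartingale. With \<open>A\<close> and \<open>a\<close>
  frozen this is exact, because a step multiplies \<open>exp disc\<close> by \<open>exp (a * \<delta>)\<close> and
  \<open>exp (a * x) * H x a\<close> is affine in \<open>x\<close>. When \<open>A\<close> shrinks, the drop of \<open>Q\<close> pays for the change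
  of \<open>a\<close>: \<open>H x\<close> increases and \<open>exp (- (a\<^sup>2)) * H x a\<close> decreases in \<open>\<bar>a\<bar>\<close>, while \<open>Q\<close> drops by at
  least \<open>a\<^sup>2 - a'\<^sup>2\<close>, and by at least \<open>a\<^sup>2\<close> if the new value \<open>a'\<close> has the opposite sign or the pivot
  itself freezes. The potential is at least \<open>1\<close> and initially at most
  \<open>exp ((norm \<theta>)\<^sup>2)\<close>, which already gives the bound with \<open>1\<close> in place of \<open>20\<close>.\<close>

section \<open>Orthogonal projections and their squared norms\<close>

text \<open>Two candidates differ by a vector in both \<open>W\<close> and its complement, hence
  orthogonal to itself; so any decomposition at hand evaluates the \<open>THE\<close> in
  \<open>orth_proj\<close>.\<close>

lemma orth_proj_unique:
  fixes W :: "'a::euclidean_space set"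
  assumes "subspace W" "w \<in> W" "y - w \<in> W\<^sup>\<bottom>"
  shows "orth_proj W y = w"
  unfolding orth_proj_def
proof (rule the_equality)
  show "w \<in> W \<and> y - w \<in> W\<^sup>\<bottom>" using assms by simp
next
  fix w' assume w': "w' \<in> W \<and> y - w' \<in> W\<^sup>\<bottom>"
  then have "(y - w) - (y - w') \<in> W\<^sup>\<bottom>"
    using assms subspace_orthogonal_comp subspace_diff by blast
  moreover have "w' - w \<in> W"
    using assms w' by (simp add: subspace_diff)
  ultimately have "orthogonal (w' - w) (w' - w)"
    by (simp add: orthogonal_comp_def)
  then show "w' = w" by (simp add: orthogonal_self)
qed

lemma orth_proj_decomp:
  fixes W :: "'a::euclidean_space set"
  assumes "subspace W"
  shows "orth_proj W y \<in> W" "y - orth_proj W y \<in> W\<^sup>\<bottom>"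
proof -
  have "y \<in> W + W\<^sup>\<bottom>" using subspace_sum_orthogonal_comp[OF assms] by simp
  then obtain a b where ab: "y = a + b" "a \<in> W" "b \<in> W\<^sup>\<bottom>" by (auto elim: set_plus_elim)
  then have "orth_proj W y = a" using assms by (intro orth_proj_unique) auto
  with ab show "orth_proj W y \<in> W" "y - orth_proj W y \<in> W\<^sup>\<bottom>" by auto
qed

lemma orthogonal_compD: "x \<in> W\<^sup>\<bottom> \<Longrightarrow> y \<in> W \<Longrightarrow> x \<bullet> y = 0"
  by (auto simp: orthogonal_comp_def orthogonal_def inner_commute)

definition proj_sq :: "'a::euclidean_space set \<Rightarrow> 'a \<Rightarrow> real" where
  "proj_sq W y = (norm (orth_proj W y))\<^sup>2"

lemma proj_sq_eq_inner:
  assumes "subspace W"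
  shows "y \<bullet> orth_proj W y = proj_sq W y"
  using orthogonal_compD[OF orth_proj_decomp(2)[OF assms, of y] orth_proj_decomp(1)[OF assms, of y]]
  by (simp add: proj_sq_def power2_norm_eq_inner inner_diff_left)

text \<open>This is nonnegativity of the squared distance from \<open>e\<close> to the projection.
  Every test vector in \<open>W\<close> thus bounds \<open>proj_sq\<close> from below, which is how
  subspaces are compared.\<close>

lemma proj_sq_ge:
  assumes "subspace W" "e \<in> W"
  shows "2 * (y \<bullet> e) - e \<bullet> e \<le> proj_sq W y"
proof -
  let ?p = "orth_proj W y"
  have "y \<bullet> e = ?p \<bullet> e"
    using orthogonal_compD[OF orth_proj_decomp(2)[OF assms(1), of y] assms(2)]
    by (simp add: inner_diff_left)
  moreover have "0 \<le> (?p - e) \<bullet> (?p - e)" by simp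
  ultimately show ?thesis
    by (simp add: proj_sq_def power2_norm_eq_inner inner_diff_left inner_diff_right inner_commute)
qed

lemma proj_sq_mono:
  assumes "subspace W" "subspace W'" "W' \<subseteq> W"
  shows "proj_sq W' y \<le> proj_sq W y"
  using proj_sq_ge[OF assms(1), of "orth_proj W' y" y] proj_sq_eq_inner[OF assms(2), of y]
    orth_proj_decomp(1)[OF assms(2), of y] assms(3)
  by (auto simp: proj_sq_def power2_norm_eq_inner)

lemma proj_sq_le_norm: "subspace W \<Longrightarrow> proj_sq W y \<le> (norm y)\<^sup>2"
  using proj_sq_mono[OF subspace_UNIV, of W y] orth_proj_unique[OF subspace_UNIV, of y y]
  by (simp add: proj_sq_def)

text \<open>The test vector is the projection onto \<open>W'\<close> plus a multiple of
  \<open>z\<close>. The factor \<open>z \<bullet> z\<close> stays on the right so that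
  \<open>z = 0\<close> is covered.\<close>

lemma proj_sq_gain:
  assumes "subspace W" "subspace W'" "W' \<subseteq> W" "z \<in> W" "\<And>x. x \<in> W' \<Longrightarrow> z \<bullet> x = 0"
  shows "(y \<bullet> z)\<^sup>2 \<le> (proj_sq W y - proj_sq W' y) * (z \<bullet> z)"
proof (cases "z = 0")
  case False
  then have zz: "z \<bullet> z > 0" by simp
  \<comment> \<open>This coefficient maximises
    \<open>2 * l * (y \<bullet> z) - l\<^sup>2 * (z \<bullet> z)\<close>.\<close>
  define l where "l = (y \<bullet> z) / (z \<bullet> z)"
  let ?p = "orth_proj W' y"
  have p: "?p \<in> W'" by (rule orth_proj_decomp(1)[OF assms(2)])
  have "?p + l *\<^sub>R z \<in> W"
    using p assms by (intro subspace_add subspace_scale) auto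
  from proj_sq_ge[OF assms(1) this, of y]
  have "proj_sq W' y + 2 * l * (y \<bullet> z) - l\<^sup>2 * (z \<bullet> z) \<le> proj_sq W y"
    using assms(5)[OF p] proj_sq_eq_inner[OF assms(2), of y]
      power2_norm_eq_inner[of ?p, folded proj_sq_def]
    by (simp add: inner_add_left inner_add_right inner_commute power2_eq_square algebra_simps)
  moreover have "2 * l * (y \<bullet> z) - l\<^sup>2 * (z \<bullet> z) = (y \<bullet> z)\<^sup>2 / (z \<bullet> z)"
    using zz by (simp add: l_def power2_eq_square field_simps)
  ultimately have "(y \<bullet> z)\<^sup>2 / (z \<bullet> z) \<le> proj_sq W y - proj_sq W' y" by simp
  then show ?thesis using zz by (simp add: pos_divide_le_eq)
qed simp

lemma inner_span_eq_zero:
  assumes "x \<in> span S" "\<And>y. y \<in> S \<Longrightarrow> z \<bullet> y = 0"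
  shows "z \<bullet> x = 0"
  using orthogonal_to_span[OF assms(1), of z] assms(2) by (auto simp: orthogonal_def inner_commute)

section \<open>Residuals and the effect of shrinking the span\<close>

definition residual :: "'a::euclidean_space set \<Rightarrow> 'a \<Rightarrow> 'a" where
  "residual S b = orth_proj ((span S)\<^sup>\<bottom>) b"

lemma residual_orth: "x \<in> span S \<Longrightarrow> residual S b \<bullet> x = 0"
  and diff_residual: "b - residual S b \<in> span S"
proof -
  have sub: "subspace ((span S)\<^sup>\<bottom>)" by (rule subspace_orthogonal_comp)
  show "x \<in> span S \<Longrightarrow> residual S b \<bullet> x = 0"
    using orth_proj_decomp(1)[OF sub] by (auto simp: residual_def intro: orthogonal_compD)
  show "b - residual S b \<in> span S"
    using orth_proj_decomp(2)[OF sub, of b] orthogonal_comp_self[OF subspace_span, of S]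
    by (simp add: residual_def)
qed

lemma residual_in_span: "residual S b \<in> span (insert b S)"
proof -
  have "b - residual S b \<in> span (insert b S)"
    using diff_residual[of b S] span_mono[of S "insert b S"] by auto
  from span_diff[OF span_base[of b "insert b S"] this] show ?thesis by simp
qed

lemma norm_residual_le: "norm (residual S b) \<le> norm b"
proof -
  let ?w = "residual S b"
  have "?w \<bullet> (b - ?w) = 0" by (intro residual_orth diff_residual)
  moreover have "0 \<le> (b - ?w) \<bullet> (b - ?w)" by simp
  ultimately have "?w \<bullet> ?w \<le> b \<bullet> b"
    by (simp add: inner_diff_left inner_diff_right inner_commute)
  then show ?thesis by (simp add: norm_le)
qed

lemma proj_sq_insert_ge:
  assumes "norm b \<le> 1"
  shows "(y \<bullet> residual S b)\<^sup>2 \<le> proj_sq (span (insert b S)) y - proj_sq (span S) y"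
proof -
  let ?w = "residual S b" and ?D = "proj_sq (span (insert b S)) y - proj_sq (span S) y"
  have "(y \<bullet> ?w)\<^sup>2 \<le> ?D * (?w \<bullet> ?w)"
    by (intro proj_sq_gain residual_in_span residual_orth span_mono) auto
  also have "\<dots> \<le> ?D * 1"
  proof (rule mult_left_mono)
    have "norm ?w \<le> 1" using norm_residual_le[of S b] assms by simp
    then have "(norm ?w)\<^sup>2 \<le> 1" by (simp add: power_le_one)
    then show "?w \<bullet> ?w \<le> 1" by (simp add: power2_norm_eq_inner)
    show "0 \<le> ?D"
      using proj_sq_mono[of "span (insert b S)" "span S" y] span_mono[of S "insert b S"] by auto
  qed
  finally show ?thesis by simp
qed

text \<open>The vector \<open>z\<close> spans the orthogonal complement of the new residual in the plane of the two
  residuals.\<close>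

lemma proj_sq_shrink:
  fixes b y :: "'a::euclidean_space"
  assumes "S' \<subseteq> S" "norm b \<le> 1"
  defines "a \<equiv> y \<bullet> residual S b" and "a' \<equiv> y \<bullet> residual S' b"
    and "D \<equiv> proj_sq (span (insert b S)) y - proj_sq (span (insert b S')) y"
  shows "a * a' \<le> 0 \<Longrightarrow> a\<^sup>2 \<le> D" "a\<^sup>2 - a'\<^sup>2 \<le> D"
proof -
  define w w' d where "w = residual S b" and "w' = residual S' b" and "d = w' - w"
  define s g where "s = w \<bullet> w" and "g = d \<bullet> d"
  define z where "z = g *\<^sub>R w - s *\<^sub>R d"
  have SS: "span S' \<subseteq> span S" using assms(1) by (rule span_mono)
  have ins: "span (insert b S') \<subseteq> span (insert b S)" "span S \<subseteq> span (insert b S)"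
    using assms(1) by (auto intro!: span_mono)
  \<comment> \<open>Both residuals differ from \<open>b\<close> by elements of
    \<open>span S\<close>, so \<open>w' = w + d\<close> is an orthogonal splitting.\<close>
  have "(b - w) - (b - w') \<in> span S"
    using SS diff_residual[of b S] diff_residual[of b S'] unfolding w_def w'_def
    by (blast intro: span_diff)
  then have d: "d \<in> span S" by (simp add: d_def)
  then have wd: "w \<bullet> d = 0" unfolding w_def by (rule residual_orth)
  have w': "w' = w + d" by (simp add: d_def)
  have zw': "z \<bullet> w' = 0"
    using wd by (simp add: z_def w' s_def g_def inner_diff_left inner_diff_right
        inner_add_left inner_add_right inner_commute)
  have zS': "z \<bullet> x = 0" if "x \<in> span S'" for x
    using residual_orth[of x S b] residual_orth[of x S' b] that SS
    by (auto simp: z_def d_def w_def w'_def inner_diff_left)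
  have zb: "z \<bullet> b = 0"
    using zS'[OF diff_residual[of b S']] zw' by (simp add: w'_def inner_diff_right)
  have zE': "z \<bullet> x = 0" if "x \<in> span (insert b S')" for x
    using that by (rule inner_span_eq_zero) (use zb zS' in \<open>auto intro: span_base\<close>)
  have "z \<in> span (insert b S)"
    unfolding z_def w_def using residual_in_span[of S b] d ins(2)
    by (intro span_diff span_scale) auto
  \<comment> \<open>\<open>z\<close> lies in the larger span and is orthogonal to the smaller one,
    so \<open>D\<close> must cover the part of \<open>y\<close> along it.\<close>
  then have "(y \<bullet> z)\<^sup>2 \<le> D * (z \<bullet> z)"
    unfolding D_def by (intro proj_sq_gain zE' ins) auto
  moreover have "y \<bullet> z = (s + g) * a - s * a'"
    by (simp add: z_def d_def a_def a'_def w_def[symmetric] w'_def[symmetric]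
        inner_diff_right algebra_simps)
  moreover have "z \<bullet> z = s * g * (s + g)"
    using wd by (simp add: z_def inner_diff_left inner_diff_right inner_commute s_def g_def algebra_simps)
  ultimately have key: "((s + g) * a - s * a')\<^sup>2 \<le> D * (s * g * (s + g))" by simp
  have D0: "0 \<le> D"
    unfolding D_def using proj_sq_mono[OF _ _ ins(1), of y] by simp
  have sg0: "0 \<le> s" "0 \<le> g" by (simp_all add: s_def g_def)
  have "w' \<bullet> w' \<le> 1"
    using norm_residual_le[of S' b] assms(2)
    by (metis w'_def dual_order.trans norm_le_square power_one zero_le_one)
  \<comment> \<open>Pythagoras: \<open>s + g\<close> is the squared norm of
    \<open>w'\<close>.\<close>
  then have sg1: "s + g \<le> 1"
    using wd by (simp add: w' s_def g_def inner_add_left inner_add_right inner_commute)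
  have a0: "a = 0" if "s = 0" using that by (simp add: s_def a_def w_def)
  have aa': "a = a'" if "g = 0" using that by (simp add: g_def d_def a_def a'_def w_def w'_def)
  have neg: "a\<^sup>2 \<le> D" if "a * a' \<le> 0"
  proof (cases "s = 0 \<or> g = 0")
    case True
    \<comment> \<open>Here \<open>z\<close> vanishes and \<open>key\<close> gives no bound on
      \<open>D\<close>, but the sign condition forces \<open>a = 0\<close>.\<close>
    then have "a = 0" using a0 aa' that by (auto simp: mult_le_0_iff)
    then show ?thesis using D0 by simp
  next
    case False
    then have pos: "s > 0" "g > 0" using sg0 by auto
    have "s * g \<le> s * 1" using sg0 sg1 by (intro mult_left_mono) auto
    then have "s * g \<le> s + g" using sg0 by simp
    then have "a\<^sup>2 * (s * g * (s + g)) \<le> a\<^sup>2 * ((s + g) * (s + g))"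
      using sg0 by (intro mult_left_mono mult_right_mono) auto
    also have "\<dots> = ((s + g) * a)\<^sup>2" by (simp add: power2_eq_square)
    \<comment> \<open>Since \<open>a * a' \<le> 0\<close>, the cross term only enlarges the
      square.\<close>
    also have "\<dots> \<le> ((s + g) * a - s * a')\<^sup>2"
    proof -
      have "s * (s + g) * (a * a') \<le> 0" using that sg0 by (simp add: mult_nonneg_nonpos)
      then have "0 \<le> (s * a')\<^sup>2 - 2 * (s * (s + g) * (a * a'))" by (smt (verit) zero_le_power2)
      then show ?thesis by (simp add: power2_eq_square algebra_simps)
    qed
    also note key
    finally show ?thesis using pos by (simp add: mult_le_cancel_right)
  qed
  then show "a * a' \<le> 0 \<Longrightarrow> a\<^sup>2 \<le> D" .
  show "a\<^sup>2 - a'\<^sup>2 \<le> D"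
  proof (cases "a * a' \<le> 0")
    case True
    then show ?thesis using neg zero_le_power2[of a'] by linarith
  next
    case same: False
    show ?thesis
    proof (cases "s = 0 \<or> g = 0 \<or> a\<^sup>2 \<le> a'\<^sup>2")
      case True
      then show ?thesis using a0 aa' D0 same by auto
    next
      case False
      then have pos: "s > 0" "g > 0" and le: "a'\<^sup>2 < a\<^sup>2" using sg0 by auto
      have c: "a * a' \<le> a\<^sup>2"
        using le sum_squares_bound[of a a'] by simp
      have "(a\<^sup>2 - a'\<^sup>2) * (s * g * (s + g)) \<le> (a\<^sup>2 - a'\<^sup>2) * (s * g * 1)"
        using pos le sg1 by (intro mult_left_mono) auto
      \<comment> \<open>The intermediate term is \<open>4 * X * Y\<close> with
        \<open>X = s * (a - a')\<close> and \<open>Y = g * a\<close>. AM-GM bounds it by the square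
        of \<open>X + Y\<close>, which is the left side of \<open>key\<close>.\<close>
      also have "\<dots> \<le> 4 * (a\<^sup>2 - a * a') * (s * g)"
      proof -
        have "0 \<le> (a - a')\<^sup>2" by simp
        then have "a\<^sup>2 - a'\<^sup>2 \<le> 4 * (a\<^sup>2 - a * a')" using c
          by (simp add: power2_diff)
        then show ?thesis using pos by (simp add: mult_right_mono)
      qed
      also have "\<dots> \<le> ((s + g) * a - s * a')\<^sup>2"
      proof -
        have "((s + g) * a - s * a')\<^sup>2 - 4 * (a\<^sup>2 - a * a') * (s * g) = (s * (a - a') - g * a)\<^sup>2"
          by (simp add: power2_eq_square algebra_simps)
        then show ?thesis by (smt (verit) zero_le_power2)
      qed
      also note key
      finally show ?thesis using pos by (simp add: mult_le_cancel_right)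
    qed
  qed
qed

section \<open>The centred moment generating function of a biased sign\<close>

text \<open>The expected value of \<open>exp (a * (X - x))\<close> for \<open>X\<close> in \<open>{-1, 1}\<close> with mean \<open>x\<close>.\<close>

definition rad_mgf :: "real \<Rightarrow> real \<Rightarrow> real" where
  "rad_mgf x a = exp (- a * x) * (cosh a + x * sinh a)"

lemma rad_mgf_0 [simp]: "rad_mgf x 0 = 1"
  by (simp add: rad_mgf_def)

lemma rad_mgf_minus: "rad_mgf x (- a) = rad_mgf (- x) a"
  by (simp add: rad_mgf_def)

text \<open>At the endpoints the sign is deterministic, so the centred variable is zero.\<close>

lemma rad_mgf_pm1: "\<bar>x\<bar> = 1 \<Longrightarrow> rad_mgf x a = 1"
  by (auto simp: rad_mgf_def abs_if cosh_def sinh_def exp_minus field_simps split: if_splits)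

lemma rad_mgf_deriv:
  "(rad_mgf x has_real_derivative exp (- a * x) * ((1 - x\<^sup>2) * sinh a)) (at a)"
  unfolding rad_mgf_def
  by (auto intro!: derivative_eq_intros simp: power2_eq_square algebra_simps)

lemma rad_mgf_mono:
  assumes "\<bar>x\<bar> \<le> 1" "0 \<le> a" "a \<le> a'"
  shows "rad_mgf x a \<le> rad_mgf x a'"
proof (rule DERIV_nonneg_imp_nondecreasing[OF assms(3)], intro exI conjI)
  fix t assume "a \<le> t"
  then show "0 \<le> exp (- t * x) * ((1 - x\<^sup>2) * sinh t)"
    using assms by (simp add: abs_square_le_1)
qed (rule rad_mgf_deriv)

lemma sinh_le_mult_cosh:
  fixes a :: real
  assumes "0 \<le> a"
  shows "sinh a \<le> a * cosh a"
proof -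
  have "0 * cosh 0 - sinh 0 \<le> a * cosh a - sinh a"
  proof (rule DERIV_nonneg_imp_nondecreasing[OF assms], intro exI conjI)
    fix t :: real assume "0 \<le> t"
    show "((\<lambda>a. a * cosh a - sinh a) has_real_derivative t * sinh t) (at t)"
      by (auto intro!: derivative_eq_intros)
    show "0 \<le> t * sinh t" using \<open>0 \<le> t\<close> by simp
  qed
  then show ?thesis by simp
qed

text \<open>The logarithmic derivative of \<open>rad_mgf x\<close> at \<open>t\<close> is at most
  \<open>2 * t\<close>, the decay rate of the Gaussian factor. As \<open>x\<close> may be negative,
  both sides are compared through \<open>1 - \<bar>x\<bar>\<close>.\<close>

lemma rad_mgf_antimono:
  assumes "\<bar>x\<bar> \<le> 1" "0 \<le> a" "a \<le> a'"
  shows "exp (- (a'\<^sup>2)) * rad_mgf x a' \<le> exp (- (a\<^sup>2)) * rad_mgf x a"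
proof (rule DERIV_nonpos_imp_nonincreasing[OF assms(3)], intro exI conjI)
  fix t assume "a \<le> t"
  then have t: "0 \<le> t" using assms by simp
  show "((\<lambda>a. exp (- (a\<^sup>2)) * rad_mgf x a) has_real_derivative
      exp (- (t\<^sup>2)) * (exp (- t * x) * ((1 - x\<^sup>2) * sinh t - 2 * t * (cosh t + x * sinh t)))) (at t)"
    by (auto intro!: derivative_eq_intros rad_mgf_deriv simp: rad_mgf_def power2_eq_square algebra_simps)
  have "(1 - x\<^sup>2) * sinh t \<le> 2 * (1 - \<bar>x\<bar>) * sinh t"
  proof (rule mult_right_mono)
    have "0 \<le> (1 - \<bar>x\<bar>)\<^sup>2" by simp
    then show "1 - x\<^sup>2 \<le> 2 * (1 - \<bar>x\<bar>)" by (simp add: power2_diff)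
  qed (use t in simp)
  also have "\<dots> \<le> 2 * (1 - \<bar>x\<bar>) * (t * cosh t)"
    using assms(1) sinh_le_mult_cosh[OF t] by (intro mult_left_mono) auto
  also have "\<dots> = 2 * t * (cosh t - \<bar>x\<bar> * cosh t)" by (simp add: algebra_simps)
  also have "\<dots> \<le> 2 * t * (cosh t + x * sinh t)"
  proof (intro mult_left_mono)
    have "\<bar>x * sinh t\<bar> \<le> \<bar>x\<bar> * cosh t"
      using t sinh_le_cosh_real[of t] by (simp add: abs_mult mult_left_mono)
    then show "cosh t - \<bar>x\<bar> * cosh t \<le> cosh t + x * sinh t" by linarith
  qed (use t in simp)
  finally show "exp (- (t\<^sup>2)) * (exp (- t * x) * ((1 - x\<^sup>2) * sinh t - 2 * t * (cosh t + x * sinh t))) \<le> 0"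
    by (simp add: mult_le_0_iff)
qed

lemma rad_mgf_ge_1: "\<bar>x\<bar> \<le> 1 \<Longrightarrow> 1 \<le> rad_mgf x a"
  using rad_mgf_mono[of x 0 a] rad_mgf_mono[of "- x" 0 "- a"] rad_mgf_minus[of "- x" a]
  by (cases "0 \<le> a") auto

lemma rad_mgf_le: "\<bar>x\<bar> \<le> 1 \<Longrightarrow> exp (- (a\<^sup>2)) * rad_mgf x a \<le> 1"
  using rad_mgf_antimono[of x 0 a] rad_mgf_antimono[of "- x" 0 "- a"] rad_mgf_minus[of "- x" a]
  by (cases "0 \<le> a") auto

text \<open>\<open>D\<close> stands for the drop of \<open>Q\<close>. If \<open>a\<close> grows, the
  Gaussian factor suffices; if it shrinks, \<open>rad_mgf\<close> decreases and \<open>D\<close>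
  pays for the Gaussian factor.\<close>

lemma rad_mgf_transfer_nonneg:
  assumes x: "\<bar>x\<bar> \<le> 1" and a: "0 \<le> a" "0 \<le> a'" and D: "0 \<le> D" "a\<^sup>2 - a'\<^sup>2 \<le> D"
  shows "exp (- (a'\<^sup>2)) * rad_mgf x a' \<le> exp (D - a\<^sup>2) * rad_mgf x a"
proof (cases "a \<le> a'")
  case True
  have "exp (- (a'\<^sup>2)) * rad_mgf x a' \<le> exp (- (a\<^sup>2)) * rad_mgf x a"
    by (rule rad_mgf_antimono[OF x a(1) True])
  also have "\<dots> \<le> exp (D - a\<^sup>2) * rad_mgf x a"
    using D rad_mgf_ge_1[OF x, of a] by (intro mult_right_mono) auto
  finally show ?thesis .
next
  case False
  then show ?thesis
    using rad_mgf_mono[OF x a(2), of a] D rad_mgf_ge_1[OF x, of a'] by (intro mult_mono) auto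
qed

text \<open>\<open>rad_mgf x\<close> is not even in \<open>a\<close>, so a sign change is routed
  through the value 1, at the price \<open>a\<^sup>2 \<le> D\<close>. Two nonpositive values reduce
  to nonnegative ones by reflecting \<open>x\<close>.\<close>

lemma rad_mgf_transfer:
  assumes x: "\<bar>x\<bar> \<le> 1" and D: "0 \<le> D" "a\<^sup>2 - a'\<^sup>2 \<le> D" "a * a' \<le> 0 \<Longrightarrow> a\<^sup>2 \<le> D"
  shows "exp (- (a'\<^sup>2)) * rad_mgf x a' \<le> exp (D - a\<^sup>2) * rad_mgf x a"
proof -
  consider "a * a' \<le> 0" | "0 \<le> a" "0 \<le> a'" | "0 \<le> - a" "0 \<le> - a'"
    by (auto simp: mult_le_0_iff) linarith
  then show ?thesis
  proof cases
    case 1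
    have "exp (- (a'\<^sup>2)) * rad_mgf x a' \<le> 1 * 1" using rad_mgf_le[OF x] by simp
    also have "\<dots> \<le> exp (D - a\<^sup>2) * rad_mgf x a"
      using D(3)[OF 1] rad_mgf_ge_1[OF x] by (intro mult_mono) auto
    finally show ?thesis .
  next
    case 2
    then show ?thesis using x D by (intro rad_mgf_transfer_nonneg) auto
  next
    case 3
    then show ?thesis
      using rad_mgf_transfer_nonneg[of "- x" "- a" "- a'" D] x D rad_mgf_minus[of "- x"] by simp
  qed
qed

section \<open>The potential and its change when the alive set shrinks\<close>

lemma finite_alive [simp]: "finite (alive n x)"
  by (simp add: alive_def)

lemma aliveD: "i \<in> alive n x \<Longrightarrow> 1 \<le> i \<and> i \<le> n \<and> \<bar>x i\<bar> < 1"
  by (simp add: alive_def)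

lemma pivot_alive: "alive n x \<noteq> {} \<Longrightarrow> pivot n x \<in> alive n x"
  by (simp add: pivot_def)

lemma v_perp_eq_residual:
  "v_perp n v x = residual (v ` (alive n x - {pivot n x})) (v (pivot n x))"
  by (simp add: v_perp_def residual_def)

lemma alive_image_pivot:
  "alive n x \<noteq> {} \<Longrightarrow> v ` alive n x = insert (v (pivot n x)) (v ` (alive n x - {pivot n x}))"
  using pivot_alive[of n x] by auto

text \<open>With nothing alive there is no pivot, and the value 1 leaves \<open>exp disc\<close>
  unweighted.\<close>

definition potential :: "nat \<Rightarrow> (nat \<Rightarrow> 'a::euclidean_space) \<Rightarrow> 'a \<Rightarrow> (nat \<Rightarrow> real) \<Rightarrow> real" where
  "potential n v \<theta> x =
     (if alive n x = {} then 1
      else exp (proj_sq (span (v ` alive n x)) \<theta> - (\<theta> \<bullet> v_perp n v x)\<^sup>2)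
             * rad_mgf (x (pivot n x)) (\<theta> \<bullet> v_perp n v x))"

text \<open>Serves twice: it makes the exponent in the potential nonnegative, and it pays for a
  pivot that freezes.\<close>

lemma proj_sq_alive_ge:
  fixes v :: "nat \<Rightarrow> 'a::euclidean_space"
  assumes "\<forall>i\<in>{1..n}. norm (v i) \<le> 1" and "alive n x \<noteq> {}"
  shows "proj_sq (span (v ` (alive n x - {pivot n x}))) \<theta>
    \<le> proj_sq (span (v ` alive n x)) \<theta> - (\<theta> \<bullet> v_perp n v x)\<^sup>2"
proof -
  have "norm (v (pivot n x)) \<le> 1"
    using assms(1) aliveD[OF pivot_alive[OF assms(2)]] by simp
  from proj_sq_insert_ge[OF this, of \<theta> "v ` (alive n x - {pivot n x})"]
  show ?thesis
    unfolding alive_image_pivot[OF assms(2)] v_perp_eq_residual by simp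
qed

lemma potential_ge_1:
  fixes v :: "nat \<Rightarrow> 'a::euclidean_space"
  assumes "\<forall>i\<in>{1..n}. norm (v i) \<le> 1"
  shows "1 \<le> potential n v \<theta> x"
proof (cases "alive n x = {}")
  case False
  have "0 \<le> proj_sq (span (v ` (alive n x - {pivot n x}))) \<theta>" by (simp add: proj_sq_def)
  also note proj_sq_alive_ge[OF assms False]
  finally have "1 * 1 \<le> exp (proj_sq (span (v ` alive n x)) \<theta> - (\<theta> \<bullet> v_perp n v x)\<^sup>2)
             * rad_mgf (x (pivot n x)) (\<theta> \<bullet> v_perp n v x)"
    using aliveD[OF pivot_alive[OF False]] by (intro mult_mono rad_mgf_ge_1) auto
  then show ?thesis using False by (simp add: potential_def)
qed (simp add: potential_def)

lemma potential_le: "potential n v \<theta> x \<le> exp (proj_sq (span (v ` alive n x)) \<theta>)"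
proof (cases "alive n x = {}")
  case True
  then show ?thesis by (simp add: potential_def proj_sq_def)
next
  case False
  let ?a = "\<theta> \<bullet> v_perp n v x" and ?Q = "proj_sq (span (v ` alive n x)) \<theta>"
  have "potential n v \<theta> x = exp ?Q * (exp (- (?a\<^sup>2)) * rad_mgf (x (pivot n x)) ?a)"
    using False by (simp add: potential_def exp_diff exp_minus field_simps)
  also have "\<dots> \<le> exp ?Q * 1"
    using aliveD[OF pivot_alive[OF False]] by (intro mult_left_mono rad_mgf_le) auto
  finally show ?thesis by simp
qed

text \<open>Separates the change of the alive set from the motion of the pivot: on the right only
  the pivot coordinate is updated, while the alive set and \<open>a\<close> stay old.\<close>

lemma potential_move:
  fixes v :: "nat \<Rightarrow> 'a::euclidean_space"
  assumes norm: "\<forall>i\<in>{1..n}. norm (v i) \<le> 1"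
    and ne: "alive n x \<noteq> {}" and sub: "alive n x' \<subseteq> alive n x" and le: "\<bar>x' (pivot n x)\<bar> \<le> 1"
  shows "potential n v \<theta> x' \<le>
    exp (proj_sq (span (v ` alive n x)) \<theta> - (\<theta> \<bullet> v_perp n v x)\<^sup>2)
      * rad_mgf (x' (pivot n x)) (\<theta> \<bullet> v_perp n v x)"
proof (cases "pivot n x \<in> alive n x'")
  case False
  then have "\<bar>x' (pivot n x)\<bar> = 1"
    using le aliveD[OF pivot_alive[OF ne]] by (auto simp: alive_def)
  then have 1: "rad_mgf (x' (pivot n x)) (\<theta> \<bullet> v_perp n v x) = 1" by (rule rad_mgf_pm1)
  \<comment> \<open>The next pivot, if any, has an unrelated residual, so the new potential is
    bounded by \<open>potential_le\<close> alone.\<close>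
  have "proj_sq (span (v ` alive n x')) \<theta> \<le> proj_sq (span (v ` (alive n x - {pivot n x}))) \<theta>"
    using sub False by (intro proj_sq_mono span_mono image_mono) auto
  also note proj_sq_alive_ge[OF norm ne]
  finally have "exp (proj_sq (span (v ` alive n x')) \<theta>)
      \<le> exp (proj_sq (span (v ` alive n x)) \<theta> - (\<theta> \<bullet> v_perp n v x)\<^sup>2)" by simp
  then show ?thesis using order.trans[OF potential_le[of n v \<theta> x']] 1 by simp
next
  case True
  let ?p = "pivot n x"
  let ?S = "v ` (alive n x - {?p})" and ?S' = "v ` (alive n x' - {?p})"
  \<comment> \<open>A maximum that survives in a subset is still its maximum, so both residuals
    belong to the same vector.\<close>
  have p: "pivot n x' = ?p"
    unfolding pivot_def[of n x']
    by (rule Max_eqI) (use True sub in \<open>auto simp: pivot_def\<close>)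
  have ne': "alive n x' \<noteq> {}" using True by auto
  have S: "?S' \<subseteq> ?S" using sub by auto
  have nb: "norm (v ?p) \<le> 1"
    using norm aliveD[OF pivot_alive[OF ne]] by simp
  define a a' where "a = \<theta> \<bullet> residual ?S (v ?p)" and "a' = \<theta> \<bullet> residual ?S' (v ?p)"
  define Q Q' where "Q = proj_sq (span (insert (v ?p) ?S)) \<theta>"
    and "Q' = proj_sq (span (insert (v ?p) ?S')) \<theta>"
  have "Q' \<le> Q" unfolding Q_def Q'_def using S by (intro proj_sq_mono span_mono) auto
  then have "exp (- (a'\<^sup>2)) * rad_mgf (x' ?p) a' \<le> exp ((Q - Q') - a\<^sup>2) * rad_mgf (x' ?p) a"
    using le proj_sq_shrink[OF S nb, of \<theta>]
    by (intro rad_mgf_transfer) (auto simp: a_def a'_def Q_def Q'_def)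
  then have "exp Q' * (exp (- (a'\<^sup>2)) * rad_mgf (x' ?p) a')
      \<le> exp Q' * (exp ((Q - Q') - a\<^sup>2) * rad_mgf (x' ?p) a)" by simp
  then have "exp (Q' - a'\<^sup>2) * rad_mgf (x' ?p) a' \<le> exp (Q - a\<^sup>2) * rad_mgf (x' ?p) a"
    by (simp add: mult.assoc[symmetric] exp_add[symmetric])
  then show ?thesis
    using ne' unfolding potential_def v_perp_eq_residual alive_image_pivot[OF ne]
      alive_image_pivot[OF ne'] p a_def a'_def Q_def Q'_def by simp
qed

section \<open>Step sizes as exit times from the cube\<close>

text \<open>Existence: take the first time a coordinate hits the boundary. Uniqueness: the maximum
  is convex in \<open>\<delta>\<close> and below 1 at 0.\<close>

lemma ex1_exit_time:
  fixes x u :: "'i \<Rightarrow> real"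
  assumes fin: "finite A" and x: "\<And>i. i \<in> A \<Longrightarrow> \<bar>x i\<bar> < 1" and p: "p \<in> A" "u p \<noteq> 0"
  shows "\<exists>!\<delta>. \<delta> > 0 \<and> Max ((\<lambda>i. \<bar>x i + \<delta> * u i\<bar>) ` A) = 1"
proof -
  define B where "B = {i \<in> A. u i \<noteq> 0}"
  \<comment> \<open>The time at which coordinate \<open>i\<close> reaches \<open>sgn (u i)\<close>,
    the face it moves towards.\<close>
  define \<tau> where "\<tau> i = (1 - sgn (u i) * x i) / \<bar>u i\<bar>" for i
  define d where "d = Min (\<tau> ` B)"
  have B: "finite B" "B \<noteq> {}" using fin p by (auto simp: B_def)
  have sx: "\<bar>sgn (u i) * x i\<bar> < 1" if "i \<in> A" for i
    using x[OF that] by (cases "u i = 0") (auto simp: abs_mult sgn_if)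
  have "0 < \<tau> i" if "i \<in> B" for i
    using sx[of i] that by (auto simp: \<tau>_def B_def)
  then have d0: "0 < d" using B by (simp add: d_def)
  have eq: "\<bar>x i + d * u i\<bar> = \<bar>sgn (u i) * x i + d * \<bar>u i\<bar>\<bar>" if "u i \<noteq> 0" for i
    using that by (auto simp: sgn_if abs_if)
  have le: "\<bar>x i + d * u i\<bar> \<le> 1" if "i \<in> A" for i
  proof (cases "u i = 0")
    case True
    then show ?thesis using x[OF that] by simp
  next
    case False
    then have "d \<le> \<tau> i" using that B by (simp add: d_def B_def)
    then have "d * \<bar>u i\<bar> \<le> 1 - sgn (u i) * x i"
      using False by (simp add: \<tau>_def pos_le_divide_eq)
    moreover have "0 \<le> d * \<bar>u i\<bar>" using d0 by simp
    ultimately show ?thesis using sx[OF that] unfolding eq[OF False] by linarith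
  qed
  have "d \<in> \<tau> ` B" using B unfolding d_def by (intro Min_in) auto
  then obtain j where j: "j \<in> B" "d = \<tau> j" by blast
  have "\<bar>x j + d * u j\<bar> = 1"
    using j by (subst eq) (auto simp: B_def \<tau>_def)
  then have "Max ((\<lambda>i. \<bar>x i + d * u i\<bar>) ` A) = 1"
    using fin le j by (intro Max_eqI) (auto simp: B_def image_iff intro!: bexI[of _ j])
  moreover have "d1 \<ge> d2" if d1: "d1 > 0" "Max ((\<lambda>i. \<bar>x i + d1 * u i\<bar>) ` A) = 1"
    and d2: "d2 > 0" "Max ((\<lambda>i. \<bar>x i + d2 * u i\<bar>) ` A) = 1" for d1 d2
  proof (rule ccontr)
    assume "\<not> d2 \<le> d1"
    \<comment> \<open>The position at \<open>d1\<close> is a convex combination of the strictly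
      interior start and the position at \<open>d2\<close>.\<close>
    define t where "t = d1 / d2"
    have t: "0 < t" "t < 1" "d1 = t * d2"
      using \<open>\<not> d2 \<le> d1\<close> d1 d2 by (auto simp: t_def)
    have "\<bar>x i + d1 * u i\<bar> < 1" if "i \<in> A" for i
    proof -
      have "\<bar>x i + d2 * u i\<bar> \<le> 1"
        using d2(2) fin that by (metis (no_types, lifting) Max_ge finite_imageI imageI)
      then have "t * \<bar>x i + d2 * u i\<bar> \<le> t" using t by simp
      moreover have "(1 - t) * \<bar>x i\<bar> < 1 - t" using x[OF that] t by simp
      moreover have "x i + d1 * u i = (1 - t) * x i + t * (x i + d2 * u i)"
        using t by (simp add: algebra_simps)
      then have "\<bar>x i + d1 * u i\<bar> \<le> (1 - t) * \<bar>x i\<bar> + t * \<bar>x i + d2 * u i\<bar>"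
        using t abs_triangle_ineq[of "(1 - t) * x i" "t * (x i + d2 * u i)"] by (simp add: abs_mult)
      ultimately show ?thesis by linarith
    qed
    then have "Max ((\<lambda>i. \<bar>x i + d1 * u i\<bar>) ` A) < 1"
      using fin p by (subst Max_less_iff) auto
    then show False using d1 by simp
  qed
  ultimately show ?thesis using d0 by (intro ex1I[of _ d]) (auto intro: antisym)
qed

lemma
  assumes "alive n x \<noteq> {}" "u (pivot n x) \<noteq> 0"
  shows delta_pos: "delta_pos n x u > 0 \<and> Max ((\<lambda>i. \<bar>x i + delta_pos n x u * u i\<bar>) ` alive n x) = 1"
    and delta_neg: "delta_neg n x u < 0 \<and> Max ((\<lambda>i. \<bar>x i + delta_neg n x u * u i\<bar>) ` alive n x) = 1"
proof -
  have ex: "\<exists>!\<delta>. \<delta> > 0 \<and> Max ((\<lambda>i. \<bar>x i + \<delta> * w i\<bar>) ` alive n x) = 1"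
    if "w (pivot n x) \<noteq> 0" for w
    using pivot_alive[OF assms(1)] that
    by (intro ex1_exit_time[where p = "pivot n x"]) (auto dest: aliveD)
  from theI'[OF ex[of u, OF assms(2)]]
  show "delta_pos n x u > 0 \<and> Max ((\<lambda>i. \<bar>x i + delta_pos n x u * u i\<bar>) ` alive n x) = 1"
    unfolding delta_pos_def .
  \<comment> \<open>Reversing \<open>u\<close> turns the negative solution into a positive
    one.\<close>
  have "\<exists>!\<delta>. \<delta> > 0 \<and> Max ((\<lambda>i. \<bar>x i + \<delta> * - u i\<bar>) ` alive n x) = 1"
    using assms(2) by (intro ex) simp
  then obtain e where e: "e > 0" "Max ((\<lambda>i. \<bar>x i + e * - u i\<bar>) ` alive n x) = 1"
    and un: "\<And>e'. e' > 0 \<Longrightarrow> Max ((\<lambda>i. \<bar>x i + e' * - u i\<bar>) ` alive n x) = 1 \<Longrightarrow> e' = e"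
    unfolding Ex1_def by blast
  have "\<exists>!\<delta>. \<delta> < 0 \<and> Max ((\<lambda>i. \<bar>x i + \<delta> * u i\<bar>) ` alive n x) = 1"
  proof (rule ex1I[of _ "- e"])
    fix \<delta> assume "\<delta> < 0 \<and> Max ((\<lambda>i. \<bar>x i + \<delta> * u i\<bar>) ` alive n x) = 1"
    then show "\<delta> = - e" using un[of "- \<delta>"] by simp
  qed (use e in simp)
  from theI'[OF this]
  show "delta_neg n x u < 0 \<and> Max ((\<lambda>i. \<bar>x i + delta_neg n x u * u i\<bar>) ` alive n x) = 1"
    unfolding delta_neg_def .
qed

section \<open>One step of the walk\<close>

text \<open>Admissibility makes the combination of the \<open>v i\<close> with weights
  \<open>u i\<close> equal to \<open>v_perp n v x\<close>.\<close>

lemma disc_move: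
  assumes "admissible_direction n v x u" "alive n x \<noteq> {}"
  shows "disc n v \<theta> x0 (\<lambda>i. x i + \<delta> * u i) = disc n v \<theta> x0 x + \<delta> * (\<theta> \<bullet> v_perp n v x)"
proof -
  let ?p = "pivot n x" and ?A = "alive n x"
  have u: "\<And>i. i \<notin> ?A \<Longrightarrow> u i = 0" "u ?p = 1"
    and w: "v_perp n v x = v ?p + (\<Sum>i \<in> ?A - {?p}. u i *\<^sub>R v i)"
    using assms(1) by (auto simp: admissible_direction_def)
  have "(\<Sum>i=1..n. u i * (\<theta> \<bullet> v i)) = (\<Sum>i\<in>?A. u i * (\<theta> \<bullet> v i))"
    using u by (intro sum.mono_neutral_right) (auto dest: aliveD)
  also have "\<dots> = \<theta> \<bullet> v_perp n v x"
    unfolding w using u pivot_alive[OF assms(2)]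
    by (simp add: sum.remove[of ?A ?p] inner_add_right inner_sum_right)
  finally have "(\<Sum>i=1..n. \<delta> * u i * (\<theta> \<bullet> v i)) = \<delta> * (\<theta> \<bullet> v_perp n v x)"
    by (simp only: mult.assoc sum_distrib_left[symmetric])
  then show ?thesis
    unfolding disc_def by (simp only: sum.distrib[symmetric] flip: \<open>_ = \<delta> * _\<close>)
      (simp add: algebra_simps)
qed

text \<open>The factor \<open>exp (\<delta> * a)\<close> from \<open>disc\<close> cancels against
  the one inside \<open>rad_mgf\<close>. What remains is affine in \<open>\<delta>\<close>, so it
  averages exactly over the two outcomes.\<close>

lemma potential_outcome:
  fixes v :: "nat \<Rightarrow> 'a::euclidean_space" and \<theta> :: 'a
  assumes norm: "\<forall>i\<in>{1..n}. norm (v i) \<le> 1"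
    and adm: "admissible_direction n v x u" and ne: "alive n x \<noteq> {}"
    and max: "Max ((\<lambda>i. \<bar>x i + \<delta> * u i\<bar>) ` alive n x) = 1"
  defines "a \<equiv> \<theta> \<bullet> v_perp n v x" and "y \<equiv> \<lambda>i. x i + \<delta> * u i"
  shows "exp (disc n v \<theta> x0 y) * potential n v \<theta> y
    \<le> exp (disc n v \<theta> x0 x) * exp (proj_sq (span (v ` alive n x)) \<theta> - a\<^sup>2 - a * x (pivot n x))
        * (cosh a + (x (pivot n x) + \<delta>) * sinh a)"
proof -
  let ?p = "pivot n x" and ?Q = "proj_sq (span (v ` alive n x)) \<theta>"
  have u: "\<And>i. i \<notin> alive n x \<Longrightarrow> u i = 0" "u ?p = 1"
    using adm by (auto simp: admissible_direction_def)
  have "\<bar>y ?p\<bar> \<le> Max ((\<lambda>i. \<bar>x i + \<delta> * u i\<bar>) ` alive n x)"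
    using pivot_alive[OF ne] unfolding y_def by (intro Max_ge) auto
  then have le: "\<bar>y ?p\<bar> \<le> 1" using max by simp
  have yp: "y ?p = x ?p + \<delta>" by (simp add: y_def u)
  have "alive n y \<subseteq> alive n x"
    using u(1) by (fastforce simp: alive_def y_def)
  from potential_move[OF norm ne this le, of \<theta>]
  have "exp (disc n v \<theta> x0 y) * potential n v \<theta> y
      \<le> exp (disc n v \<theta> x0 x + \<delta> * a) * (exp (?Q - a\<^sup>2) * rad_mgf (x ?p + \<delta>) a)"
    using disc_move[OF adm ne, of \<theta> x0 \<delta>, folded y_def a_def] by (simp add: a_def yp)
  also have "\<dots> = exp (disc n v \<theta> x0 x + \<delta> * a + (?Q - a\<^sup>2) + - a * (x ?p + \<delta>))
      * (cosh a + (x ?p + \<delta>) * sinh a)"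
    unfolding rad_mgf_def exp_add by (simp only: mult.assoc)
  also have "disc n v \<theta> x0 x + \<delta> * a + (?Q - a\<^sup>2) + - a * (x ?p + \<delta>)
      = disc n v \<theta> x0 x + (?Q - a\<^sup>2 - a * x ?p)"
    by (simp add: algebra_simps)
  finally show ?thesis by (simp add: exp_add)
qed

lemma gsw_step_supermartingale:
  fixes v :: "nat \<Rightarrow> 'a::euclidean_space"
  assumes norm: "\<forall>i\<in>{1..n}. norm (v i) \<le> 1"
    and adm: "alive n x \<noteq> {} \<Longrightarrow> admissible_direction n v x u"
  shows "(\<integral>\<^sup>+y. ennreal (exp (disc n v \<theta> x0 y) * potential n v \<theta> y) \<partial>gsw_step n x u)
    \<le> ennreal (exp (disc n v \<theta> x0 x) * potential n v \<theta> x)"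
proof (cases "alive n x = {}")
  case True
  then show ?thesis by (simp add: gsw_step_def)
next
  case ne: False
  define F where "F y = exp (disc n v \<theta> x0 y) * potential n v \<theta> y" for y
  define a where "a = \<theta> \<bullet> v_perp n v x"
  define C where "C = exp (disc n v \<theta> x0 x)
      * exp (proj_sq (span (v ` alive n x)) \<theta> - a\<^sup>2 - a * x (pivot n x))"
  define dp dn where "dp = delta_pos n x u" and "dn = delta_neg n x u"
  define q where "q = - dn / (dp - dn)"
  have up: "u (pivot n x) \<noteq> 0"
    using adm[OF ne] by (simp add: admissible_direction_def)
  have d: "dp > 0" "dn < 0"
    using delta_pos[of n x u, OF ne up] delta_neg[of n x u, OF ne up] by (simp_all add: dp_def dn_def)
  \<comment> \<open>\<open>q\<close> is the probability of the positive outcome; the last identity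
    says that the step has mean zero.\<close>
  then have q: "0 \<le> q" "q \<le> 1" "q * dp + (1 - q) * dn = 0"
    by (auto simp: q_def field_simps)
  have step: "gsw_step n x u
      = map_pmf (\<lambda>b i. x i + (if b then dp else dn) * u i) (bernoulli_pmf q)"
    using ne by (simp only: gsw_step_def dp_def dn_def q_def if_False)
  have Fle: "F (\<lambda>i. x i + \<delta> * u i) \<le> C * (cosh a + (x (pivot n x) + \<delta>) * sinh a)"
    if "\<delta> = dp \<or> \<delta> = dn" for \<delta>
    unfolding F_def C_def a_def using that delta_pos[of n x u, OF ne up] delta_neg[of n x u, OF ne up]
    by (intro potential_outcome norm adm ne) (auto simp: dp_def dn_def)
  have F0: "0 \<le> F y" for y
    using order.trans[OF zero_le_one potential_ge_1[OF norm, of \<theta> y]] by (simp add: F_def)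
  have "(\<integral>\<^sup>+y. ennreal (F y) \<partial>gsw_step n x u)
      = ennreal (F (\<lambda>i. x i + dp * u i)) * ennreal q + ennreal (F (\<lambda>i. x i + dn * u i)) * ennreal (1 - q)"
    unfolding step using q by (simp add: ennreal_minus_if)
  also have "\<dots> = ennreal (F (\<lambda>i. x i + dp * u i) * q + F (\<lambda>i. x i + dn * u i) * (1 - q))"
    using F0 q by (simp add: ennreal_mult ennreal_plus)
  also have "\<dots> \<le> ennreal (F x)"
  proof (rule ennreal_leI)
    have "F (\<lambda>i. x i + dp * u i) * q + F (\<lambda>i. x i + dn * u i) * (1 - q)
        \<le> C * (cosh a + (x (pivot n x) + dp) * sinh a) * q
          + C * (cosh a + (x (pivot n x) + dn) * sinh a) * (1 - q)"
      using q by (intro add_mono mult_right_mono Fle) auto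
    \<comment> \<open>The part linear in the step collects into its mean, which vanishes.\<close>
    also have "\<dots> = C * (cosh a + x (pivot n x) * sinh a)
        + C * sinh a * (q * dp + (1 - q) * dn)"
      by (simp add: algebra_simps)
    also have "\<dots> = F x"
      using ne unfolding q(3) F_def potential_def C_def rad_mgf_def a_def[symmetric]
      by (simp add: exp_diff exp_minus divide_inverse mult_ac)
    finally show "F (\<lambda>i. x i + dp * u i) * q + F (\<lambda>i. x i + dn * u i) * (1 - q) \<le> F x" .
  qed
  finally show ?thesis unfolding F_def .
qed

section \<open>Iteration over the walk and the final bound\<close>

lemma gsw_history_supermartingale:
  fixes v :: "nat \<Rightarrow> 'a::euclidean_space"
  assumes norm: "\<forall>i\<in>{1..n}. norm (v i) \<le> 1" and rule: "direction_rule n v U"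
  shows "(\<integral>\<^sup>+h. ennreal (exp (disc n v \<theta> x0 (hd h)) * potential n v \<theta> (hd h)) \<partial>gsw_history n U x0 t)
    \<le> ennreal (potential n v \<theta> x0)"
proof (induction t)
  case 0
  then show ?case by (simp add: disc_def)
next
  case (Suc t)
  let ?F = "\<lambda>y. ennreal (exp (disc n v \<theta> x0 y) * potential n v \<theta> y)"
  \<comment> \<open>\<open>direction_rule\<close> constrains \<open>U\<close> only on lists of the
    form \<open>x # h\<close>.\<close>
  have nonempty: "h \<noteq> []" if "h \<in> set_pmf (gsw_history n U x0 t)" for h
    using that by (cases t) auto
  have "(\<integral>\<^sup>+h. ?F (hd h) \<partial>gsw_history n U x0 (Suc t))
      = (\<integral>\<^sup>+h. (\<integral>\<^sup>+y. ?F y \<partial>gsw_step n (hd h) (U h)) \<partial>gsw_history n U x0 t)"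
    by simp
  also have "\<dots> \<le> (\<integral>\<^sup>+h. ?F (hd h) \<partial>gsw_history n U x0 t)"
  proof (rule nn_integral_mono_AE, unfold AE_measure_pmf_iff, intro ballI)
    fix h assume "h \<in> set_pmf (gsw_history n U x0 t)"
    then have "alive n (hd h) \<noteq> {} \<Longrightarrow> admissible_direction n v (hd h) (U h)"
      using rule nonempty[of h] by (cases h) (auto simp: direction_rule_def)
    then show "(\<integral>\<^sup>+y. ?F y \<partial>gsw_step n (hd h) (U h)) \<le> ?F (hd h)"
      by (intro gsw_step_supermartingale norm)
  qed
  also note Suc
  finally show ?case .
qed

theorem theorem14:
  fixes n :: nat and v :: "nat \<Rightarrow> real ^ 'm" and \<theta> :: "real ^ 'm"
    and x0 :: "nat \<Rightarrow> real" and U :: "(nat \<Rightarrow> real) list \<Rightarrow> nat \<Rightarrow> real"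
  assumes "\<And>i. i \<in> {1..n} \<Longrightarrow> norm (v i) \<le> 1"
    and "\<And>i. i \<in> {1..n} \<Longrightarrow> x0 i \<in> {-1..1}"
    and "direction_rule n v U"
  shows "measure_pmf.expectation (gsw_output n U x0) (\<lambda>x. exp (disc n v \<theta> x0 x))
           \<le> exp (20 * (norm \<theta>)\<^sup>2)"
proof -
  have norm: "\<forall>i\<in>{1..n}. norm (v i) \<le> 1" using assms(1) by blast
  \<comment> \<open>Monotonicity of nonnegative integrals needs no integrability; the real
    expectation is recovered at the end.\<close>
  have "(\<integral>\<^sup>+x. ennreal (exp (disc n v \<theta> x0 x)) \<partial>gsw_output n U x0)
      = (\<integral>\<^sup>+h. ennreal (exp (disc n v \<theta> x0 (hd h))) \<partial>gsw_history n U x0 n)"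
    by (simp add: gsw_output_def)
  also have "\<dots> \<le> (\<integral>\<^sup>+h. ennreal (exp (disc n v \<theta> x0 (hd h)) * potential n v \<theta> (hd h))
      \<partial>gsw_history n U x0 n)"
    using potential_ge_1[OF norm, of \<theta>] by (intro nn_integral_mono ennreal_leI) simp
  also have "\<dots> \<le> ennreal (potential n v \<theta> x0)"
    by (intro gsw_history_supermartingale norm assms(3))
  also have "\<dots> \<le> ennreal (exp (20 * (norm \<theta>)\<^sup>2))"
  proof (rule ennreal_leI)
    have "proj_sq (span (v ` alive n x0)) \<theta> \<le> (norm \<theta>)\<^sup>2" by (rule proj_sq_le_norm) simp
    also have "\<dots> \<le> 20 * (norm \<theta>)\<^sup>2" by simp
    finally show "potential n v \<theta> x0 \<le> exp (20 * (norm \<theta>)\<^sup>2)"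
      using potential_le[of n v \<theta> x0] by (meson exp_le_cancel_iff order_trans)
  qed
  finally show ?thesis
    by (subst integral_eq_nn_integral) (auto intro: enn2real_leI)
qed

end
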